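(* Let $K$ be a field of characteristic zero with algebraic closure $\overline{K}$. Let $p = \sum_{i=0}^n c_i x^{n-i} \in K[x]$ be a monic polynomial such that $p(0) \neq 0$. Suppose $p = \prod_{i=1}^t q_i^{m_i}$ for (known) $q_i \in K[x]$. The multiplicity vector $\mathbf{m} = \langle m_1, \dots, m_t \rangle^T$ is uniquely determined by the first $t$ proper coefficients of $p$ if and only if $V \in \overline{K}^{t \times t}$ is non-singular, where \[ V_{i,j} = \sum_{r \,:\, q_i(r) = 0} r^j . \]
   Context: The first $t$ proper (leading) coefficients of $p = \sum_{i=0}^n c_i x^{n-i}$ are $c_1, \dots, c_t$, where $c_i$ is the coefficient of $x^{n-i}$ (codegree $i$). In the definition of $V$, the indices $i, j$ run over $1, \dots, t$ and the sum is over the roots $r$ of $q_i$ in $\overline{K}$.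
   Formalization: "Uniquely determined" means unique among vectors with entries in K (powers by binomial series), since the "only if" fails for natural multiplicities, e.g. over Q(√2); roots in V are counted with multiplicity, and each q_i is nonzero. *)

theory Defs
  imports
    "HOL-Algebra.Algebraic_Closure_Type"
    "HOL-Computational_Algebra.Computational_Algebra"
    "Jordan_Normal_Form.Determinant"
begin

text \<open>
  The coefficient of \<open>x\<^sup>n\<^sup>-\<^sup>j\<close> in a polynomial of degree \<open>n\<close>; it is \<open>0\<close> when \<open>j > n\<close>.
\<close>

definition codegree_coeff :: "'a::zero poly \<Rightarrow> nat \<Rightarrow> 'a" where
  "codegree_coeff p j = (if j \<le> degree p then Polynomial.coeff p (degree p - j) else 0)"

text \<open>
  For \<open>q \<noteq> 0\<close>, the coefficients of the monic associate of \<open>q\<close>, listed by codegree, as a power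
  series with constant term \<open>1\<close>.  Listing by codegree is multiplicative.
\<close>

definition codegree_series :: "'a::field poly \<Rightarrow> 'a fps" where
  "codegree_series q = Abs_fps (codegree_coeff (smult (inverse (lead_coeff q)) q))"

text \<open>
  \<open>f\<^sup>a\<close> for a power series \<open>f\<close> with constant term \<open>1\<close> and an exponent \<open>a\<close> in the coefficient
  field, by the binomial series \<open>(1 + u)\<^sup>a = \<Sum>\<^sub>k (a gchoose k) u\<^sup>k\<close> at \<open>u = f - 1\<close>.
\<close>

definition fps_gpower :: "'a::field_char_0 fps \<Rightarrow> 'a \<Rightarrow> 'a fps" where
  "fps_gpower f a = fps_compose (fps_binomial a) (f - 1)"

text \<open>
  The codegree coefficients of \<open>\<Prod>\<^sub>i q\<^sub>i\<^bsup>x\<^sub>i\<^esup>\<close> for a vector \<open>x\<close> with entries in the field.  If every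
  \<open>x\<^sub>i\<close> is a natural number, these are the coefficients of the (monic associate of the) actual
  polynomial product; see \<open>product_series_of_nat\<close> below.
\<close>

definition product_series ::
    "nat \<Rightarrow> (nat \<Rightarrow> 'a::field_char_0 poly) \<Rightarrow> (nat \<Rightarrow> 'a) \<Rightarrow> 'a fps" where
  "product_series t q x = (\<Prod>i\<in>{1..t}. fps_gpower (codegree_series (q i)) (x i))"

text \<open>
  The multiplicity vector \<open>m\<close> is the only vector whose product has the same coefficients of
  codegree \<open>1, \<dots>, t\<close> as \<open>p\<close>.  The competing vectors have entries in the field \<open>K\<close>, not only
  natural numbers.  With natural numbers alone, the equivalence with non-singularity fails over
  \<open>K = \<rat>(\<surd>2)\<close>: for \<open>q\<^sub>1 = x - 1\<close> and \<open>q\<^sub>2 = x\<^sup>2 - \<surd>2 x + (1 - \<surd>2/2)\<close> the power sums of the roots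
  are \<open>1, 1\<close> and \<open>\<surd>2, \<surd>2\<close>, so \<open>V\<close> is singular, although \<open>c\<^sub>1 = -(m\<^sub>1 + \<surd>2 m\<^sub>2)\<close> already
  determines natural (even rational) \<open>m\<^sub>1, m\<^sub>2\<close>.
\<close>

definition multiplicities_determined ::
    "nat \<Rightarrow> (nat \<Rightarrow> 'a::field_char_0 poly) \<Rightarrow> 'a poly \<Rightarrow> (nat \<Rightarrow> nat) \<Rightarrow> bool" where
  "multiplicities_determined t q p m \<longleftrightarrow>
     (\<forall>x :: nat \<Rightarrow> 'a.
        (\<forall>j\<in>{1..t}. fps_nth (product_series t q x) j = codegree_coeff p j) \<longrightarrow>
        (\<forall>i\<in>{1..t}. x i = of_nat (m i)))"

text \<open>
  The sum of \<open>r\<^sup>j\<close> over the roots \<open>r\<close> of \<open>q\<close> in the algebraic closure, where a root of order \<open>k\<close>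
  counts \<open>k\<close> times.  For \<open>q\<close> without repeated roots this is the sum over the set of roots; see
  \<open>root_power_sum_squarefree\<close> below.
\<close>

definition root_power_sum :: "'a::field poly \<Rightarrow> nat \<Rightarrow> 'a alg_closure" where
  "root_power_sum q j =
     (let q' = map_poly to_ac q in \<Sum>r | poly q' r = 0. of_nat (order r q') * r ^ j)"

text \<open>Matrix indices start at \<open>0\<close>, while \<open>i\<close> and \<open>j\<close> run over \<open>1, \<dots>, t\<close>.\<close>

definition root_power_matrix :: "nat \<Rightarrow> (nat \<Rightarrow> 'a::field poly) \<Rightarrow> 'a alg_closure mat" where
  "root_power_matrix t q = mat t t (\<lambda>(i, j). root_power_sum (q (i + 1)) (j + 1))"


subsection \<open>Agreement with the elementary notions\<close>

lemma codegree_series_altdef: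
  "codegree_series q = fps_of_poly (reflect_poly (smult (inverse (lead_coeff q)) q))"
  by (auto simp: codegree_series_def codegree_coeff_def fps_eq_iff coeff_reflect_poly)

lemma codegree_series_nth_0: "q \<noteq> 0 \<Longrightarrow> fps_nth (codegree_series q) 0 = 1"
  by (simp add: codegree_series_altdef)

lemma fps_gpower_of_nat:
  assumes "fps_nth f 0 = 1"
  shows "fps_gpower f (of_nat n) = f ^ n"
proof -
  have "fps_nth (f - 1) 0 = 0"
    using assms by simp
  thus ?thesis
    by (simp add: fps_gpower_def fps_binomial_of_nat flip: fps_compose_power)
       (simp add: fps_compose_add_distrib)
qed

lemma product_series_of_nat:
  fixes q :: "nat \<Rightarrow> 'a::field_char_0 poly"
  assumes "\<And>i. i \<in> {1..t} \<Longrightarrow> q i \<noteq> 0"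
  assumes "lead_coeff (\<Prod>i\<in>{1..t}. q i ^ m i) = 1"
  shows "fps_nth (product_series t q (\<lambda>i. of_nat (m i))) j =
           codegree_coeff (\<Prod>i\<in>{1..t}. q i ^ m i) j"
proof -
  have "(\<Prod>i\<in>{1..t}. smult (inverse (lead_coeff (q i))) (q i) ^ m i) =
        smult (\<Prod>i\<in>{1..t}. inverse (lead_coeff (q i)) ^ m i) (\<Prod>i\<in>{1..t}. q i ^ m i)"
    by (simp add: smult_power prod_smult)
  also have "(\<Prod>i\<in>{1..t}. inverse (lead_coeff (q i)) ^ m i) =
             inverse (lead_coeff (\<Prod>i\<in>{1..t}. q i ^ m i))"
    by (simp add: lead_coeff_prod lead_coeff_power power_inverse o_def
             flip: prod_inversef)
  finally have eq: "(\<Prod>i\<in>{1..t}. smult (inverse (lead_coeff (q i))) (q i) ^ m i) =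
                    (\<Prod>i\<in>{1..t}. q i ^ m i)"
    by (simp only: assms(2) inverse_1 smult_1_left)
  have "product_series t q (\<lambda>i. of_nat (m i)) = (\<Prod>i\<in>{1..t}. codegree_series (q i) ^ m i)"
    unfolding product_series_def
    by (intro prod.cong refl fps_gpower_of_nat codegree_series_nth_0 assms(1))
  also have "\<dots> = fps_of_poly (reflect_poly
               (\<Prod>i\<in>{1..t}. smult (inverse (lead_coeff (q i))) (q i) ^ m i))"
    by (simp add: codegree_series_altdef reflect_poly_prod reflect_poly_power
          fps_of_poly_prod fps_of_poly_power)
  finally show ?thesis
    unfolding eq by (simp add: coeff_reflect_poly codegree_coeff_def)
qed

lemma multiplicities_determined_nat:
  fixes q :: "nat \<Rightarrow> 'a::field_char_0 poly"
  assumes "multiplicities_determined t q p m"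
  assumes "\<And>i. i \<in> {1..t} \<Longrightarrow> q i \<noteq> 0"
  assumes "lead_coeff (\<Prod>i\<in>{1..t}. q i ^ m' i) = 1"
  assumes "\<And>j. j \<in> {1..t} \<Longrightarrow> codegree_coeff (\<Prod>i\<in>{1..t}. q i ^ m' i) j = codegree_coeff p j"
  shows "\<forall>i\<in>{1..t}. m' i = m i"
proof -
  have "fps_nth (product_series t q (\<lambda>i. of_nat (m' i))) j = codegree_coeff p j"
    if "j \<in> {1..t}" for j
    using assms(4)[OF that] product_series_of_nat[of t q m' j] assms(2,3) by simp
  hence "\<forall>i\<in>{1..t}. (of_nat (m' i) :: 'a) = of_nat (m i)"
    using assms(1) unfolding multiplicities_determined_def by blast
  thus ?thesis
    by simp
qed

lemma root_power_sum_squarefree: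
  assumes "rsquarefree (map_poly to_ac q)"
  shows "root_power_sum q j = (\<Sum>r | poly (map_poly to_ac q) r = 0. r ^ j)"
proof -
  have "order r (map_poly to_ac q) = 1" if "poly (map_poly to_ac q) r = 0" for r
    using assms that by (metis order_root rsquarefree_def)
  thus ?thesis
    by (simp add: root_power_sum_def)
qed

end

theory Submission
  imports Defs
begin

text \<open>
  Let \<open>f\<^sub>i\<close> be the codegree series of \<open>q\<^sub>i\<close>.  The logarithmic derivative turns
  \<open>\<Prod>\<^sub>i f\<^sub>i\<^bsup>x\<^sub>i\<^esup>\<close> into \<open>\<Sum>\<^sub>i x\<^sub>i (f\<^sub>i' / f\<^sub>i)\<close>, and in characteristic zero the coefficients
  \<open>1, \<dots>, t\<close> of a series with constant term \<open>1\<close> and the coefficients \<open>0, \<dots>, t - 1\<close> of its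
  logarithmic derivative determine each other (Newton's identities).  So the vectors \<open>x\<close> with the
  same first \<open>t\<close> proper coefficients as \<open>p\<close> are the solutions of a square linear system over \<open>K\<close>.
  Splitting \<open>q\<^sub>i\<close> over the algebraic closure, \<open>f\<^sub>i = \<Prod>\<^sub>r (1 - r X)\<close>, whose logarithmic derivative
  has the coefficients \<open>- \<Sum>\<^sub>r r\<^bsup>j + 1\<^esup>\<close>, shows that the matrix of this system is \<open>-V\<close>.
\<close>

subsection \<open>Logarithmic derivatives of power series\<close>

definition fps_log_deriv :: "'a::field fps \<Rightarrow> 'a fps" where
  "fps_log_deriv f = fps_deriv f * inverse f"

lemma fps_log_deriv_mult_self:
  assumes "fps_nth f 0 \<noteq> 0"
  shows "fps_log_deriv f * f = fps_deriv f"
  using inverse_mult_eq_1[OF assms] by (simp add: fps_log_deriv_def mult.assoc)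

text \<open>Power series over a field form an integral domain, so \<open>f\<close> cancels. Later
  logarithmic derivatives are identified by checking \<open>L * f = fps_deriv f\<close>, without
  computing an inverse.\<close>

lemma fps_log_deriv_eqI:
  assumes "fps_nth f 0 \<noteq> 0" "L * f = fps_deriv f"
  shows "fps_log_deriv f = L"
proof -
  have "f \<noteq> 0"
    using assms(1) by auto
  thus ?thesis
    using fps_log_deriv_mult_self[OF assms(1)] assms(2) by (metis mult_right_cancel)
qed

lemma fps_log_deriv_1 [simp]: "fps_log_deriv 1 = 0"
  by (simp add: fps_log_deriv_def)

lemma fps_log_deriv_mult:
  assumes "fps_nth f 0 \<noteq> 0" "fps_nth g 0 \<noteq> 0"
  shows "fps_log_deriv (f * g) = fps_log_deriv f + fps_log_deriv g"
proof (rule fps_log_deriv_eqI)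
  have "(fps_log_deriv f + fps_log_deriv g) * (f * g) =
          (fps_log_deriv f * f) * g + f * (fps_log_deriv g * g)"
    by (simp add: algebra_simps)
  also have "\<dots> = fps_deriv (f * g)"
    using assms by (simp add: fps_log_deriv_mult_self add.commute)
  finally show "(fps_log_deriv f + fps_log_deriv g) * (f * g) = fps_deriv (f * g)" .
qed (use assms in simp)

lemma fps_prod_nth_0: "fps_nth (prod f A) 0 = (\<Prod>x\<in>A. fps_nth (f x) 0)"
  by (induction A rule: infinite_finite_induct) simp_all

lemma fps_log_deriv_prod:
  assumes "\<And>x. x \<in> A \<Longrightarrow> fps_nth (f x) 0 \<noteq> 0"
  shows "fps_log_deriv (\<Prod>x\<in>A. f x) = (\<Sum>x\<in>A. fps_log_deriv (f x))"
  using assms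
  by (induction A rule: infinite_finite_induct)
     (simp_all add: fps_log_deriv_mult fps_prod_nth_0)

lemma fps_prod_mset_nth_0: "fps_nth (\<Prod>x\<in>#A. f x) 0 = (\<Prod>x\<in>#A. fps_nth (f x) 0)"
  by (induction A) simp_all

lemma fps_log_deriv_prod_mset:
  assumes "\<And>x. x \<in># A \<Longrightarrow> fps_nth (f x) 0 \<noteq> 0"
  shows "fps_log_deriv (\<Prod>x\<in>#A. f x) = (\<Sum>x\<in>#A. fps_log_deriv (f x))"
  using assms
proof (induction A)
  case (add a A)
  have "fps_nth (\<Prod>x\<in>#A. f x) 0 \<noteq> 0"
    unfolding fps_prod_mset_nth_0 prod_mset_zero_iff using add.prems by force
  with add show ?case
    by (simp add: fps_log_deriv_mult)
qed simp

text \<open>This is the geometric series of \<open>-c / (1 - c X)\<close>.\<close>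

lemma fps_log_deriv_linear:
  "fps_log_deriv (1 - fps_const c * fps_X) = Abs_fps (\<lambda>j. - (c ^ Suc j))"
proof (rule fps_log_deriv_eqI)
  show "Abs_fps (\<lambda>j. - (c ^ Suc j)) * (1 - fps_const c * fps_X) =
          fps_deriv (1 - fps_const c * fps_X)"
  proof (rule fps_ext)
    fix n
    define L where "L = Abs_fps (\<lambda>j. - (c ^ Suc j))"
    have "L * (1 - fps_const c * fps_X) = L - fps_const c * (L * fps_X)"
      by (simp add: right_diff_distrib mult.left_commute)
    thus "fps_nth (L * (1 - fps_const c * fps_X)) n =
            fps_nth (fps_deriv (1 - fps_const c * fps_X)) n"
      by (cases n) (simp_all add: L_def)
  qed
qed simp

section \<open>Powers with exponents in the field\<close>

lemma fps_gpower_nth_0 [simp]: "fps_nth (fps_gpower f a) 0 = 1"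
  by (simp add: fps_gpower_def)

text \<open>Chain rule for \<open>B oo (f - 1)\<close>, where the binomial series \<open>B\<close>
  satisfies \<open>(1 + X) B' = a B\<close>.\<close>

lemma fps_log_deriv_gpower:
  assumes "fps_nth f 0 = 1"
  shows "fps_log_deriv (fps_gpower f a) = fps_const a * fps_log_deriv f"
proof (rule fps_log_deriv_eqI)
  have f0: "fps_nth (f - 1) 0 = 0" and f: "fps_nth f 0 \<noteq> 0"
    using assms by simp_all
  have "fps_binomial a * fps_const a = fps_deriv (fps_binomial a) * (1 + fps_X)"
    by (simp add: fps_binomial_deriv fps_divide_unit mult.assoc inverse_mult_eq_1)
  \<comment> \<open>Substituting \<open>f - 1\<close>, which has constant term 0, turns the factor
    \<open>1 + fps_X\<close> into \<open>f\<close>.\<close>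
  hence "(fps_binomial a * fps_const a) oo (f - 1) =
           (fps_deriv (fps_binomial a) * (1 + fps_X)) oo (f - 1)"
    by simp
  hence "fps_gpower f a * fps_const a = (fps_deriv (fps_binomial a) oo (f - 1)) * f"
    using f0 by (simp add: fps_gpower_def fps_compose_mult_distrib fps_compose_add_distrib)
  hence "fps_const a * fps_log_deriv f * fps_gpower f a =
           (fps_deriv (fps_binomial a) oo (f - 1)) * (fps_log_deriv f * f)"
    by (simp add: algebra_simps)
  also have "\<dots> = fps_deriv (fps_gpower f a)"
    using f f0 by (simp add: fps_log_deriv_mult_self fps_gpower_def fps_compose_deriv)
  finally show "fps_const a * fps_log_deriv f * fps_gpower f a = fps_deriv (fps_gpower f a)" .
qed simp

section \<open>Newton's identities\<close>

lemma fps_nth_Suc_log_deriv: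
  assumes "fps_nth f 0 = 1"
  shows "of_nat (Suc n) * fps_nth f (Suc n) =
           fps_nth (fps_log_deriv f) n + (\<Sum>i<n. fps_nth (fps_log_deriv f) i * fps_nth f (n - i))"
proof -
  have "of_nat (Suc n) * fps_nth f (Suc n) = fps_nth (fps_log_deriv f * f) n"
    using assms by (simp add: fps_log_deriv_mult_self)
  also have "\<dots> = (\<Sum>i\<le>n. fps_nth (fps_log_deriv f) i * fps_nth f (n - i))"
    by (simp add: fps_mult_nth atLeast0AtMost)
  \<comment> \<open>The summand \<open>i = n\<close> is split off; its second factor is the constant
    term 1.\<close>
  finally show ?thesis
    using assms by (simp add: lessThan_Suc_atMost[symmetric])
qed

text \<open>Induction on \<open>t\<close>: once the earlier coefficients agree, the sums in Newton's
  identity coincide, so the next coefficients on the two sides determine each other.\<close>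

lemma fps_nth_eq_iff_log_deriv:
  fixes f g :: "'a::field_char_0 fps"
  assumes f: "fps_nth f 0 = 1" and g: "fps_nth g 0 = 1"
  shows "(\<forall>j\<in>{1..t}. fps_nth f j = fps_nth g j) \<longleftrightarrow>
           (\<forall>j<t. fps_nth (fps_log_deriv f) j = fps_nth (fps_log_deriv g) j)"
proof (induction t)
  case (Suc t)
  have "fps_nth f (Suc t) = fps_nth g (Suc t) \<longleftrightarrow>
          fps_nth (fps_log_deriv f) t = fps_nth (fps_log_deriv g) t"
    if "\<forall>j\<in>{1..t}. fps_nth f j = fps_nth g j"
       "\<forall>j<t. fps_nth (fps_log_deriv f) j = fps_nth (fps_log_deriv g) j"
  proof -
    have "(\<Sum>i<t. fps_nth (fps_log_deriv f) i * fps_nth f (t - i)) =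
            (\<Sum>i<t. fps_nth (fps_log_deriv g) i * fps_nth g (t - i))"
      using that by (intro sum.cong) auto
    \<comment> \<open>Characteristic zero makes \<open>Suc t\<close> cancellable.\<close>
    moreover have "fps_nth f (Suc t) = fps_nth g (Suc t) \<longleftrightarrow>
        of_nat (Suc t) * fps_nth f (Suc t) = of_nat (Suc t) * fps_nth g (Suc t)"
      by (metis mult_left_cancel of_nat_neq_0)
    ultimately show ?thesis
      by (simp only: fps_nth_Suc_log_deriv[OF f] fps_nth_Suc_log_deriv[OF g] add_right_cancel)
  qed
  thus ?case
    using Suc.IH by (auto simp: less_Suc_eq atLeastAtMostSuc_conv)
qed simp

subsection \<open>Power sums of roots\<close>

lemma codegree_series_smult:
  assumes "c \<noteq> 0"
  shows "codegree_series (smult c q) = codegree_series q"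
  using assms by (simp add: codegree_series_def field_simps)

text \<open>Coefficient reversal is multiplicative and sends \<open>x - a\<close> to
  \<open>1 - a X\<close>.\<close>

lemma codegree_series_prod_linear:
  "codegree_series (\<Prod>x\<in>#A. [:-x, 1:]) = (\<Prod>x\<in>#A. 1 - fps_const x * fps_X)"
proof -
  have monic: "lead_coeff (\<Prod>x\<in>#A. [:-x, 1:]) = 1"
    by (induction A) (simp_all add: lead_coeff_mult del: mult_pCons_left)
  have "fps_of_poly (reflect_poly (\<Prod>x\<in>#A. [:-x, 1:])) = (\<Prod>x\<in>#A. 1 - fps_const x * fps_X)"
  proof (induction A)
    case (add a A)
    have "fps_of_poly (reflect_poly [:-a, 1:]) = 1 - fps_const a * fps_X"
      by (simp add: reflect_poly_def fps_of_poly_pCons)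
    with add show ?case
      by (simp add: reflect_poly_mult fps_of_poly_mult del: mult_pCons_left)
  qed simp
  with monic show ?thesis
    by (simp add: codegree_series_altdef)
qed

lemma order_prod_linear:
  "order r (\<Prod>x\<in>#A. [:-x, 1:]) = count A r"
proof (induction A)
  case (add a A)
  have "order r [:-a, 1:] = (if r = a then 1 else 0)"
    using order_power_n_n[of a 1] by (auto intro: order_0I)
  moreover have "[:-a, 1:] * (\<Prod>x\<in>#A. [:-x, 1:]) \<noteq> 0"
    by (auto simp: prod_mset_zero_iff simp del: mult_pCons_left)
  ultimately show ?case
    by (simp add: order_mult add del: mult_pCons_left)
qed simp

text \<open>Links the multiset of roots given by a factorization to the weighted sum over distinct
  roots in \<open>root_power_sum\<close>.\<close>

lemma sum_mset_eq_sum_count: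
  fixes f :: "'a \<Rightarrow> 'b::semiring_1"
  shows "(\<Sum>x\<in>#A. f x) = (\<Sum>x\<in>set_mset A. of_nat (count A x) * f x)"
proof (induction A)
  case (add a A)
  have "(\<Sum>x\<in>set_mset (add_mset a A). of_nat (count (add_mset a A) x) * f x) =
          (\<Sum>x\<in>set_mset (add_mset a A). of_nat (count A x) * f x + (if x = a then f x else 0))"
    by (intro sum.cong) (auto simp: algebra_simps)
  also have "\<dots> = (\<Sum>x\<in>set_mset (add_mset a A). of_nat (count A x) * f x) + f a"
    by (simp add: sum.distrib)
  also have "(\<Sum>x\<in>set_mset (add_mset a A). of_nat (count A x) * f x) =
               (\<Sum>x\<in>set_mset A. of_nat (count A x) * f x)"
    by (intro sum.mono_neutral_right) (auto simp: not_in_iff)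
  finally show ?case
    using add by (simp add: add.commute)
qed simp

text \<open>Factoring \<open>q\<close> into linear terms yields one geometric series per root,
  counted with multiplicity.\<close>

lemma fps_log_deriv_codegree_series:
  fixes q :: "'a::alg_closed_field poly"
  assumes "q \<noteq> 0"
  shows "fps_nth (fps_log_deriv (codegree_series q)) j =
           - (\<Sum>r | poly q r = 0. of_nat (order r q) * r ^ Suc j)"
proof -
  obtain A where q: "q = smult (lead_coeff q) (\<Prod>x\<in>#A. [:-x, 1:])"
    using alg_closed_imp_factorization[OF assms] by auto
  have lc: "lead_coeff q \<noteq> 0"
    using assms by simp
  have order_eq: "order r q = count A r" for r
    by (metis q lc order_smult order_prod_linear)
  have roots: "{r. poly q r = 0} = set_mset A"
    using assms by (auto simp: order_root order_eq)
  have "fps_log_deriv (codegree_series q) = (\<Sum>x\<in>#A. Abs_fps (\<lambda>j. - (x ^ Suc j)))"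
    by (subst q, subst codegree_series_smult[OF lc], subst codegree_series_prod_linear,
        subst fps_log_deriv_prod_mset) (simp_all add: fps_log_deriv_linear)
  also have "fps_nth \<dots> j = (\<Sum>x\<in>#A. - (x ^ Suc j))"
    by (induction A) simp_all
  also have "\<dots> = - (\<Sum>r\<in>set_mset A. of_nat (count A r) * r ^ Suc j)"
    by (simp add: sum_mset_eq_sum_count sum_negf)
  finally show ?thesis
    by (simp add: roots order_eq)
qed

text \<open>Logarithmic derivatives commute with the embedding of \<open>K\<close> into its closure,
  so the power sums already come from \<open>K\<close>.\<close>

lemma root_power_sum_eq:
  fixes q :: "'a::field poly"
  assumes "q \<noteq> 0"
  shows "root_power_sum q (Suc j) = - to_ac (fps_nth (fps_log_deriv (codegree_series q)) j)"
proof -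
  define q' where "q' = map_poly to_ac q"
  define f where "f = codegree_series q"
  have deg: "degree q' = degree q"
    by (simp add: q'_def degree_map_poly)
  have q': "q' \<noteq> 0"
    using assms by (simp add: q'_def map_poly_eq_0_iff)
  have f0: "fps_nth f 0 = 1"
    using assms by (simp add: f_def codegree_series_nth_0)
  have f': "codegree_series q' = Abs_fps (\<lambda>n. to_ac (fps_nth f n))"
    by (rule fps_ext)
       (use assms in \<open>simp add: codegree_series_def codegree_coeff_def f_def deg,
                      simp add: q'_def coeff_map_poly\<close>)
  have "fps_log_deriv (codegree_series q') =
          Abs_fps (\<lambda>n. to_ac (fps_nth (fps_log_deriv f) n))"
  proof (rule fps_log_deriv_eqI)
    show "Abs_fps (\<lambda>n. to_ac (fps_nth (fps_log_deriv f) n)) * codegree_series q' =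
            fps_deriv (codegree_series q')"
    proof (rule fps_ext)
      fix n
      have "to_ac (fps_nth (fps_log_deriv f * f) n) = to_ac (fps_nth (fps_deriv f) n)"
        using f0 by (simp add: fps_log_deriv_mult_self)
      thus "fps_nth (Abs_fps (\<lambda>n. to_ac (fps_nth (fps_log_deriv f) n)) * codegree_series q') n =
              fps_nth (fps_deriv (codegree_series q')) n"
        by (simp add: f' fps_mult_nth to_ac_sum)
    qed
  qed (use f0 f' in simp)
  thus ?thesis
    using fps_log_deriv_codegree_series[OF q', of j]
    by (simp add: root_power_sum_def Let_def q'_def f_def)
qed

subsection \<open>Non-singular matrices\<close>

lemma invertible_mat_iff_det:
  fixes A :: "'a::field mat"
  assumes A: "A \<in> carrier_mat n n"
  shows "invertible_mat A \<longleftrightarrow> det A \<noteq> 0"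
proof
  assume "invertible_mat A"
  then obtain B where AB: "A * B = 1\<^sub>m n" and BA: "B * A = 1\<^sub>m (dim_row B)"
    using A by (auto simp: invertible_mat_def inverts_mat_def)
  \<comment> \<open>Comparing column counts in \<open>AB\<close> and \<open>BA\<close> recovers the
    shape of \<open>B\<close>, which \<open>invertible_mat\<close> leaves open.\<close>
  have "dim_col B = n" "dim_row B = n"
    using AB BA A by (metis carrier_matD(2) index_mult_mat(3) index_one_mat(3))+
  hence "B \<in> carrier_mat n n"
    by blast
  hence "det A * det B = 1"
    using det_mult[OF A, of B] AB by simp
  thus "det A \<noteq> 0"
    by auto
next
  assume "det A \<noteq> 0"
  \<comment> \<open>Here \<open>()\<close> is a dummy for the record extension of
    \<open>ring_mat\<close>.\<close>
  from det_non_zero_imp_unit[OF A this, of "()"] obtain B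
    where "B \<in> carrier_mat n n" "A * B = 1\<^sub>m n" "B * A = 1\<^sub>m n"
    by (auto simp: Units_def ring_mat_def)
  thus "invertible_mat A"
    using A by (auto simp: invertible_mat_def inverts_mat_def)
qed

text \<open>A row relation is a kernel vector of the transpose. Rows matter because the unknown
  multiplicities weight the rows, one for each \<open>q i\<close>.\<close>

lemma det_nonzero_iff_rows_independent:
  fixes A :: "'a::field mat"
  assumes A: "A \<in> carrier_mat n n"
  shows "det A \<noteq> 0 \<longleftrightarrow>
    (\<forall>y. (\<forall>j<n. (\<Sum>i<n. y i * A $$ (i, j)) = 0) \<longrightarrow> (\<forall>i<n. y i = 0))"
proof -
  have combination: "transpose_mat A *\<^sub>v vec n y = 0\<^sub>v n \<longleftrightarrow> (\<forall>j<n. (\<Sum>i<n. y i * A $$ (i, j)) = 0)"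
    for y
    using A by (auto simp: vec_eq_iff scalar_prod_def lessThan_atLeast0 mult.commute)
  have "det A = 0 \<longleftrightarrow>
      (\<exists>v. v \<in> carrier_vec n \<and> v \<noteq> 0\<^sub>v n \<and> transpose_mat A *\<^sub>v v = 0\<^sub>v n)"
    using det_0_iff_vec_prod_zero_field[of "transpose_mat A" n] A by (simp add: det_transpose[OF A])
  also have "\<dots> \<longleftrightarrow> (\<exists>y. vec n y \<noteq> 0\<^sub>v n \<and> transpose_mat A *\<^sub>v vec n y = 0\<^sub>v n)"
  proof safe
    fix v assume "v \<in> carrier_vec n" "v \<noteq> 0\<^sub>v n" "transpose_mat A *\<^sub>v v = 0\<^sub>v n"
    moreover from this(1) have "vec n (vec_index v) = v"
      by auto
    ultimately show "\<exists>y. vec n y \<noteq> 0\<^sub>v n \<and> transpose_mat A *\<^sub>v vec n y = 0\<^sub>v n"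
      by metis
  qed (blast intro: vec_carrier)
  also have "\<dots> \<longleftrightarrow> (\<exists>y. \<not> (\<forall>i<n. y i = 0) \<and> (\<forall>j<n. (\<Sum>i<n. y i * A $$ (i, j)) = 0))"
    by (simp only: combination) (simp add: vec_eq_iff)
  finally show ?thesis
    by blast
qed

section \<open>Uniqueness as a square linear system over \<open>K\<close>\<close>

theorem theorem1p4:
  fixes p :: "'k::field_char_0 poly"
    and q :: "nat \<Rightarrow> 'k poly"
    and m :: "nat \<Rightarrow> nat"
    and t :: nat
  assumes "lead_coeff p = 1"
    and "poly p 0 \<noteq> 0"
    and "\<And>i. i \<in> {1..t} \<Longrightarrow> q i \<noteq> 0"
    and "p = (\<Prod>i\<in>{1..t}. q i ^ m i)"
  shows "multiplicities_determined t q p m \<longleftrightarrow> invertible_mat (root_power_matrix t q)"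
proof -
  define L where "L i = fps_log_deriv (codegree_series (q i))" for i
  define W where "W = mat t t (\<lambda>(i, j). fps_nth (L (Suc i)) j)"
  have W: "W \<in> carrier_mat t t"
    by (simp add: W_def)
  interpret to_ac: comm_ring_hom "to_ac :: 'k \<Rightarrow> 'k alg_closure"
    by unfold_locales simp_all

  have log_deriv: "fps_log_deriv (product_series t q x) = (\<Sum>i\<in>{1..t}. fps_const (x i) * L i)" for x
    unfolding product_series_def L_def using assms(3)
    by (subst fps_log_deriv_prod)
       (auto intro!: sum.cong fps_log_deriv_gpower codegree_series_nth_0)
  have nth_0: "fps_nth (product_series t q x) 0 = 1" for x
    by (simp add: product_series_def fps_prod_nth_0)
  \<comment> \<open>Since \<open>p\<close> is itself the product series at \<open>m\<close>,
    agreement with \<open>p\<close> compares two product series.\<close>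
  have p: "codegree_coeff p j = fps_nth (product_series t q (\<lambda>i. of_nat (m i))) j" for j
    using product_series_of_nat[of t q m j] assms by simp
  have agree: "(\<forall>j\<in>{1..t}. fps_nth (product_series t q x) j = codegree_coeff p j) \<longleftrightarrow>
      (\<forall>j<t. (\<Sum>i<t. (x (Suc i) - of_nat (m (Suc i))) * W $$ (i, j)) = 0)" for x
  proof -
    have "fps_nth (fps_log_deriv (product_series t q x)) j -
            fps_nth (fps_log_deriv (product_series t q (\<lambda>i. of_nat (m i)))) j =
          (\<Sum>i<t. (x (Suc i) - of_nat (m (Suc i))) * W $$ (i, j))" if "j < t" for j
    proof -
      have "fps_nth (fps_log_deriv (product_series t q x)) j -
              fps_nth (fps_log_deriv (product_series t q (\<lambda>i. of_nat (m i)))) j =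
            (\<Sum>i\<in>{1..t}. (x i - of_nat (m i)) * fps_nth (L i) j)"
        by (simp add: log_deriv fps_sum_nth left_diff_distrib sum_subtractf)
      also have "\<dots> = (\<Sum>i<t. (x (Suc i) - of_nat (m (Suc i))) * fps_nth (L (Suc i)) j)"
        by (simp add: sum.atLeast1_atMost_eq)
      finally show ?thesis
        using that by (simp add: W_def)
    qed
    thus ?thesis
      unfolding p fps_nth_eq_iff_log_deriv[OF nth_0 nth_0] by (metis (no_types, lifting) right_minus_eq)
  qed
  have "multiplicities_determined t q p m \<longleftrightarrow>
      (\<forall>y. (\<forall>j<t. (\<Sum>i<t. y i * W $$ (i, j)) = 0) \<longrightarrow> (\<forall>i<t. y i = 0))"
  proof
    assume det: "multiplicities_determined t q p m"
    show "\<forall>y. (\<forall>j<t. (\<Sum>i<t. y i * W $$ (i, j)) = 0) \<longrightarrow> (\<forall>i<t. y i = 0)"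
    proof (intro allI impI)
      fix y i
      assume "\<forall>j<t. (\<Sum>i<t. y i * W $$ (i, j)) = 0" "i < t"
      \<comment> \<open>Shifting \<open>m\<close> by the homogeneous solution \<open>y\<close> gives
        a competing vector; \<open>i - 1\<close> translates to indices from 0.\<close>
      thus "y i = 0"
        using det[unfolded multiplicities_determined_def agree, rule_format,
                  of "\<lambda>i. y (i - 1) + of_nat (m i)" "Suc i"]
        by simp
    qed
  next
    assume indep: "\<forall>y. (\<forall>j<t. (\<Sum>i<t. y i * W $$ (i, j)) = 0) \<longrightarrow> (\<forall>i<t. y i = 0)"
    show "multiplicities_determined t q p m"
      unfolding multiplicities_determined_def agree
    proof (intro allI impI ballI)
      fix x i
      assume "\<forall>j<t. (\<Sum>i<t. (x (Suc i) - of_nat (m (Suc i))) * W $$ (i, j)) = 0"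
      hence "\<forall>i<t. x (Suc i) - of_nat (m (Suc i)) = 0"
        using indep[rule_format, of "\<lambda>i. x (Suc i) - of_nat (m (Suc i))"] by blast
      moreover assume "i \<in> {1..t}"
      ultimately show "x i = of_nat (m i)"
        by (cases i) auto
    qed
  qed
  also have "\<dots> \<longleftrightarrow> det W \<noteq> 0"
    using det_nonzero_iff_rows_independent[OF W] by simp
  also have "\<dots> \<longleftrightarrow> det (root_power_matrix t q) \<noteq> 0"
  proof -
    \<comment> \<open>The determinants differ by the sign \<open>(-1) ^ t\<close> and the injective
      map \<open>to_ac\<close>, so they vanish together.\<close>
    have "root_power_matrix t q = (-1) \<cdot>\<^sub>m map_mat to_ac W"
      using assms(3) by (intro eq_matI) (auto simp: root_power_matrix_def W_def L_def root_power_sum_eq)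
    thus ?thesis
      by (simp add: det_smult)
  qed
  also have "\<dots> \<longleftrightarrow> invertible_mat (root_power_matrix t q)"
    by (subst invertible_mat_iff_det[of _ t]) (auto simp: root_power_matrix_def)
  finally show ?thesis .
qed

end
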